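(* Let $n \geq 1$, $T > 0$, $b_1, \ldots, b_n \in \{-1,+1\}$, let $f : \mathbb{R}\setminus\{0\} \to \mathbb{R}$ and $g : \mathbb{R} \to \mathbb{R}$ satisfy the standing assumptions on $f,g$ listed in the context (with exponent $a > 0$), and let $x_1^\circ < \ldots < x_n^\circ$ be initial positions of the particles. Consider the solution, in the sense described in the context, on $[0,T]$ of the particle system with annihilation $$\frac{dx_i}{dt} = \sum_{j \neq i} b_i b_j f(x_i - x_j) + b_i g(x_i), \qquad \text{with annihilation upon collision},$$ starting at $x_1^\circ, \ldots, x_n^\circ$, and let $0 < \tau_1 < \ldots < \tau_K < T$ be its collision times. Set $\tau_0 = 0$ and $\tau_{K+1} = T$. Then, for each $1 \leq k \leq K+1$, each particle trajectory on $[\tau_{k-1}, \tau_k]$ is H\"older continuous with exponent $\frac{1}{1+a}$.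
   Context: Standing assumptions on $f,g$: $g : \mathbb{R} \to \mathbb{R}$ is Lipschitz continuous, and $f : \mathbb{R}\setminus\{0\} \to \mathbb{R}$ satisfies: (i) $f$ is odd; (ii) there exists $a > 0$ such that $f = f_a + f_{\rm reg}$, where $f_a(x) := \operatorname{sgn}(x)/|x|^a$ and $f_{\rm reg} \in W^{2,1}_{\rm loc}(\mathbb{R}\setminus\{0\})$ is such that the limits $f_{\rm reg}(0+) = \lim_{x \downarrow 0} f_{\rm reg}(x)$ and $f_{\rm reg}'(0+) = \lim_{x\downarrow 0} f_{\rm reg}'(x)$ exist in $\mathbb{R}$; (iii) on $(0,\infty)$, $f \geq 0$, $f' \leq 0$ and $f'' \geq 0$ (the last one almost everywhere). Solution of the system with annihilation. The numbers $b_i$ are the fixed signs of the particles. The solution is constructed iteratively over the collision times. It consists of collision times $0 = \tau_0 < \tau_1 < \ldots < \tau_K < \tau_{K+1} = T$, index sets of surviving particles $\{1,\ldots,n\} = I_1 \supset I_2 \supset \ldots \supset I_{K+1}$, and trajectories $x_i$ such that: (1) For each $1 \leq k \leq K+1$ and $i \in I_k$, $x_i$ is defined on $[\tau_{k-1},\tau_k]$ and $x_i \in C([\tau_{k-1},\tau_k]) \cap C^1([\tau_{k-1},\tau_k))$. The positions $x_i(t)$, $i \in I_k$, are pairwise distinct for all $t \in [\tau_{k-1},\tau_k)$, and for all $t \in (\tau_{k-1},\tau_k)$ and $i \in I_k$ $$\frac{dx_i}{dt}(t) = \sum_{j \in I_k, \, j \neq i} b_i b_j f(x_i(t) - x_j(t))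 + b_i g(x_i(t)).$$ (2) $x_i(0) = x_i^\circ$ for all $1 \leq i \leq n$, and for $1 \leq k \leq K$ and $i \in I_{k+1}$ the trajectory $x_i$ is continuous across $\tau_k$. (3) For each $1 \leq k \leq K$ at least two particles in $I_k$ are at the same position at time $\tau_k$ (a collision), and $I_{k+1}$ is obtained from $I_k$ by sequentially removing pairs $\{i,j\}$ with $x_i(\tau_k) = x_j(\tau_k)$ and $b_i b_j = -1$ until no such pair is left. Such a solution is unique up to relabelling of the particles (i.e. up to the choice of which pairs are removed). The particle trajectories on $[\tau_{k-1},\tau_k]$ are the functions $x_i|_{[\tau_{k-1},\tau_k]}$ with $i \in I_k$. *)

theory Defs
  imports "HOL-Analysis.Analysis"
begin

section \<open>Local Sobolev regularity on open subsets of the real line\<close>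

definition locally_integrable :: "real set \<Rightarrow> (real \<Rightarrow> real) \<Rightarrow> bool" where
  "locally_integrable S u \<longleftrightarrow> (\<forall>K. compact K \<and> K \<subseteq> S \<longrightarrow> u absolutely_integrable_on K)"

definition test_function :: "real set \<Rightarrow> (real \<Rightarrow> real) \<Rightarrow> bool" where
  "test_function S \<phi> \<longleftrightarrow>
     (\<forall>k x. ((deriv ^^ k) \<phi>) differentiable (at x)) \<and>
     compact (closure {x. \<phi> x \<noteq> 0}) \<and> closure {x. \<phi> x \<noteq> 0} \<subseteq> S"

definition weak_deriv :: "real set \<Rightarrow> (real \<Rightarrow> real) \<Rightarrow> (real \<Rightarrow> real) \<Rightarrow> bool" where
  "weak_deriv S u v \<longleftrightarrow>
     locally_integrable S u \<and> locally_integrable S v \<and>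
     (\<forall>\<phi>. test_function S \<phi> \<longrightarrow>
        (LINT x:S|lebesgue. u x * deriv \<phi> x) = - (LINT x:S|lebesgue. v x * \<phi> x))"

definition W21_loc :: "real set \<Rightarrow> (real \<Rightarrow> real) \<Rightarrow> bool" where
  "W21_loc S u \<longleftrightarrow> (\<exists>v w. weak_deriv S u v \<and> weak_deriv S v w)"

section \<open>The interaction force\<close>

definition f_sing :: "real \<Rightarrow> real \<Rightarrow> real" where
  "f_sing a x = sgn x / \<bar>x\<bar> powr a"

text \<open>
  The functions \<open>f\<close> and \<open>f_reg\<close> live on \<open>\<real> - {0}\<close>; their values at \<open>0\<close> are never used.
  Elements of \<open>W\<^sup>2\<^sup>,\<^sup>1\<^sub>l\<^sub>o\<^sub>c\<close> on the line have a (unique) \<open>C\<^sup>1\<close> representative. As the pointwise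
  values of \<open>f_reg\<close> and \<open>f_reg'\<close> are used, \<open>f_reg\<close> is this representative and \<open>f_reg'\<close> and \<open>f'\<close>
  are classical derivatives. The second derivative \<open>f''\<close> is the weak derivative of \<open>f'\<close>, which
  is unique up to null sets.
\<close>

definition admissible_force :: "real \<Rightarrow> (real \<Rightarrow> real) \<Rightarrow> bool" where
  "admissible_force a f \<longleftrightarrow>
     (\<forall>x. x \<noteq> 0 \<longrightarrow> f (- x) = - f x) \<and>
     (\<exists>f_reg.
        (\<forall>x. x \<noteq> 0 \<longrightarrow> f x = f_sing a x + f_reg x) \<and>
        W21_loc (- {0}) f_reg \<and>
        f_reg C1_differentiable_on (- {0}) \<and>
        (\<exists>l. (f_reg \<longlongrightarrow> l) (at_right 0)) \<and>
        (\<exists>l. (deriv f_reg \<longlongrightarrow> l) (at_right 0))) \<and>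
     (\<forall>x>0. f x \<ge> 0) \<and>
     (\<forall>x>0. deriv f x \<le> 0) \<and>
     (\<exists>f''. weak_deriv {0<..} (deriv f) f'' \<and> (AE x in lebesgue. x > 0 \<longrightarrow> f'' x \<ge> 0))"

section \<open>The particle system with annihilation\<close>

definition C1_within :: "real set \<Rightarrow> (real \<Rightarrow> real) \<Rightarrow> bool" where
  "C1_within S u \<longleftrightarrow>
     (\<exists>u'. (\<forall>t\<in>S. (u has_real_derivative u' t) (at t within S)) \<and> continuous_on S u')"

text \<open>
  \<open>annihilation_step b p I J\<close>: from the index set \<open>I\<close> of particles with signs \<open>b\<close> and positions
  \<open>p\<close>, one pair of coinciding particles of opposite sign is removed (\<open>b i * b j = -1\<close> with
  signs \<open>\<plusminus>1\<close> forces \<open>i \<noteq> j\<close>).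
\<close>

definition annihilation_step ::
    "(nat \<Rightarrow> real) \<Rightarrow> (nat \<Rightarrow> real) \<Rightarrow> nat set \<Rightarrow> nat set \<Rightarrow> bool" where
  "annihilation_step b p I J \<longleftrightarrow>
     (\<exists>i\<in>I. \<exists>j\<in>I. p i = p j \<and> b i * b j = -1 \<and> J = I - {i, j})"

definition annihilation ::
    "(nat \<Rightarrow> real) \<Rightarrow> (nat \<Rightarrow> real) \<Rightarrow> nat set \<Rightarrow> nat set \<Rightarrow> bool" where
  "annihilation b p I J \<longleftrightarrow>
     (annihilation_step b p)\<^sup>*\<^sup>* I J \<and> \<not> (\<exists>J'. annihilation_step b p J J')"

text \<open>
  Particles are indexed by \<open>{1..n}\<close>, collision times by \<open>{1..K}\<close>, and the surviving index sets
  \<open>I k\<close> by \<open>{1..K+1}\<close>. A trajectory \<open>x i\<close> is a total function of time, but it is constrained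
  only up to the end of the last interval \<open>{\<tau> (k-1)..\<tau> k}\<close> with \<open>i \<in> I k\<close>.
\<close>

definition annihilation_solution ::
    "nat \<Rightarrow> real \<Rightarrow> (nat \<Rightarrow> real) \<Rightarrow> (real \<Rightarrow> real) \<Rightarrow> (real \<Rightarrow> real) \<Rightarrow> (nat \<Rightarrow> real) \<Rightarrow>
     nat \<Rightarrow> (nat \<Rightarrow> real) \<Rightarrow> (nat \<Rightarrow> nat set) \<Rightarrow> (nat \<Rightarrow> real \<Rightarrow> real) \<Rightarrow> bool" where
  "annihilation_solution n T b f g x0 K \<tau> I x \<longleftrightarrow>
     \<tau> 0 = 0 \<and> \<tau> (K + 1) = T \<and> (\<forall>k\<in>{1..K+1}. \<tau> (k - 1) < \<tau> k) \<and>
     I 1 = {1..n} \<and> (\<forall>k\<in>{1..K}. I (k + 1) \<subset> I k) \<and>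
     (\<forall>k\<in>{1..K+1}.
        (\<forall>i\<in>I k.
           continuous_on {\<tau> (k - 1)..\<tau> k} (x i) \<and> C1_within {\<tau> (k - 1)..<\<tau> k} (x i)) \<and>
        (\<forall>t\<in>{\<tau> (k - 1)..<\<tau> k}. inj_on (\<lambda>i. x i t) (I k)) \<and>
        (\<forall>i\<in>I k. \<forall>t\<in>{\<tau> (k - 1)<..<\<tau> k}.
           (x i has_real_derivative
              (\<Sum>j\<in>I k - {i}. b i * b j * f (x i t - x j t)) + b i * g (x i t)) (at t))) \<and>
     (\<forall>i\<in>{1..n}. x i 0 = x0 i) \<and>
     (\<forall>k\<in>{1..K}. \<forall>i\<in>I (k + 1). isCont (x i) (\<tau> k)) \<and>
     (\<forall>k\<in>{1..K}.
        (\<exists>i\<in>I k. \<exists>j\<in>I k. i \<noteq> j \<and> x i (\<tau> k) = x j (\<tau> k)) \<and>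
        annihilation b (\<lambda>i. x i (\<tau> k)) (I k) (I (k + 1)))"

definition holder_continuous_on :: "real \<Rightarrow> real set \<Rightarrow> (real \<Rightarrow> real) \<Rightarrow> bool" where
  "holder_continuous_on \<gamma> S u \<longleftrightarrow>
     (\<exists>C\<ge>0. \<forall>s\<in>S. \<forall>t\<in>S. \<bar>u s - u t\<bar> \<le> C * \<bar>s - t\<bar> powr \<gamma>)"

end

theory Submission
  imports Defs
begin

text \<open>
  Order the particles and consider the gaps between neighbours between two collision times.
  At a time when a same-sign gap \<open>d\<close> is the smallest among all same-sign gaps, the forces of the other
  particles on this pair telescope, by convexity of \<open>z powr (- a)\<close> and by cancellation between neighbours
  of opposite sign, so that \<open>d\<close> grows at least at the rate \<open>2 * (m * d) powr (- a) - const\<close>. Hence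
  same-sign gaps stay bounded away from \<open>0\<close>. After this, only attraction is unbounded: a particle moves
  to the left (right) with at most the speed \<open>m * d powr (- a) + const\<close>, where \<open>d\<close> is the gap to its left
  (right) neighbour. It follows that a gap \<open>d\<close> persists for a time of order \<open>d powr (1 + a)\<close>. Given a
  time step \<open>r powr (1 + a)\<close>, group together particles whose gaps are less than a fixed multiple of \<open>r\<close>:
  the outermost particles of a group move outwards by at most \<open>O(r)\<close>, and they confine all the others.
\<close>

section \<open>Convexity and cancellation in signed sums of powers\<close>

lemma powr_neg_antimono:
  fixes a u v :: real
  assumes "a > 0" "0 < u" "u \<le> v"
  shows "v powr (-a) \<le> u powr (-a)"
  using assms by (intro powr_mono2') auto

text \<open>Convexity of \<open>z powr (-a)\<close>: over a step of fixed length \<open>d\<close> it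
  drops less the further out the step is taken, because \<open>z powr (-a - 1)\<close> is
  decreasing.\<close>

lemma powr_neg_diff_antimono:
  fixes a d u v :: real
  assumes "a > 0" "d \<ge> 0" "0 < u" "u \<le> v"
  shows "v powr (-a) - (v + d) powr (-a) \<le> u powr (-a) - (u + d) powr (-a)"
proof (rule DERIV_nonpos_imp_nonincreasing[OF \<open>u \<le> v\<close>])
  fix z assume z: "u \<le> z" "z \<le> v"
  have "((\<lambda>z. z powr (-a) - (z + d) powr (-a)) has_real_derivative
          a * ((z + d) powr (-a - 1) - z powr (-a - 1))) (at z)"
    using z assms by (auto intro!: derivative_eq_intros simp: algebra_simps)
  moreover have "(z + d) powr (-a - 1) \<le> z powr (-a - 1)"
    using z assms by (intro powr_mono2') auto
  hence "a * ((z + d) powr (-a - 1) - z powr (-a - 1)) \<le> 0"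
    using assms by (simp add: mult_nonneg_nonpos)
  ultimately show "\<exists>y. ((\<lambda>z. z powr (-a) - (z + d) powr (-a)) has_real_derivative y) (at z) \<and> y \<le> 0"
    by blast
qed

text \<open>A positive term that follows a negative one is absorbed by it, as \<open>h\<close> is
  nonincreasing. Only positive terms whose predecessor is also positive survive. Index 0 stands for
  the reference particle, which has no term of its own.\<close>

lemma signed_sum_le_sum_repeated_signs:
  fixes s h :: "nat \<Rightarrow> real"
  assumes "s 0 = 1"
    and "\<And>k. k \<le> m \<Longrightarrow> s k \<in> {-1, 1}"
    and "\<And>k. \<lbrakk>1 \<le> k; Suc k \<le> m\<rbrakk> \<Longrightarrow> h (Suc k) \<le> h k"
    and "\<And>k. \<lbrakk>1 \<le> k; k \<le> m\<rbrakk> \<Longrightarrow> 0 \<le> h k"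
  shows "(\<Sum>k=1..m. s k * h k) \<le> (\<Sum>k=1..m. if s k = 1 \<and> s (k - 1) = 1 then h k else 0)"
proof -
  let ?G = "\<lambda>m. \<Sum>k=1..m. if s k = 1 \<and> s (k - 1) = 1 then h k else 0"
  \<comment> \<open>The induction needs a stronger claim: if the last sign is negative, its term is
    added back on the left, so it is kept in reserve to absorb a positive term at
    \<open>Suc l\<close>.\<close>
  have "(\<Sum>k=1..l. s k * h k) + (if s l = 1 then 0 else h l) \<le> ?G l" if "l \<le> m" for l
    using that
  proof (induction l)
    case 0
    then show ?case using assms(1) by simp
  next
    case (Suc l)
    have IH: "(\<Sum>k=1..l. s k * h k) + (if s l = 1 then 0 else h l) \<le> ?G l"
      using Suc by simp
    have pos: "0 \<le> (if s l = 1 then 0 else h l)"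
      using assms(1) assms(4)[of l] Suc.prems by (cases l) auto
    show ?case
    proof (cases "s (Suc l) = 1")
      case True
      show ?thesis
      proof (cases "s l = 1")
        case False
        hence "h (Suc l) \<le> h l"
          using assms(1) assms(3)[of l] Suc.prems by (cases l) auto
        then show ?thesis using True False IH by simp
      qed (use True IH in simp)
    next
      case False
      hence "s (Suc l) = -1" using assms(2)[OF Suc.prems] by auto
      then show ?thesis using IH pos by simp
    qed
  qed
  from this[of m] assms(1) assms(4)[of m] show ?thesis
    by (cases m) (auto split: if_splits)
qed

text \<open>Here \<open>z k\<close> is the distance of the \<open>k\<close>-th particle on one side
  of a reference particle, and \<open>s k\<close> is its sign relative to it. After cancellation
  only terms closing a same-sign gap remain. Each of them is at most \<open>d powr (-a)\<close>,
  which gives the first bound. The \<open>j\<close>-th of them lies at distance at least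
  \<open>j * d\<close>, so by convexity the differences in the second bound telescope.\<close>

lemma signed_potential_sum_le:
  fixes s z :: "nat \<Rightarrow> real" and a d :: real
  assumes "a > 0" "d > 0" "s 0 = 1" "z 0 = 0"
    and sgn: "\<And>k. k \<le> m \<Longrightarrow> s k \<in> {-1, 1}"
    and inc: "\<And>k. Suc k \<le> m \<Longrightarrow> z k < z (Suc k)"
    and sep: "\<And>k. \<lbrakk>Suc k \<le> m; s k = s (Suc k)\<rbrakk> \<Longrightarrow> d \<le> z (Suc k) - z k"
  shows "(\<Sum>k=1..m. s k * z k powr (-a)) \<le> real m * d powr (-a)"
    and "(\<Sum>k=1..m. s k * (z k powr (-a) - (z k + d) powr (-a)))
           \<le> d powr (-a) - (real (Suc m) * d) powr (-a)"
proof -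
  have nonneg: "0 \<le> z k" if "k \<le> m" for k
    using that
  proof (induction k)
    case (Suc k) then show ?case using inc[of k] by simp
  qed (use assms in simp)
  have pos: "0 < z k" if "1 \<le> k" "k \<le> m" for k
  proof -
    from that have "Suc (k - 1) = k" "k - 1 \<le> m" by auto
    with inc[of "k - 1"] nonneg[of "k - 1"] that show ?thesis by simp
  qed
  show "(\<Sum>k=1..m. s k * z k powr (-a)) \<le> real m * d powr (-a)"
  proof -
    have "(\<Sum>k=1..m. s k * z k powr (-a))
        \<le> (\<Sum>k=1..m. if s k = 1 \<and> s (k - 1) = 1 then z k powr (-a) else 0)"
    proof (rule signed_sum_le_sum_repeated_signs)
      show "z (Suc k) powr (-a) \<le> z k powr (-a)" if "1 \<le> k" "Suc k \<le> m" for k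
        using powr_neg_antimono[OF \<open>a > 0\<close> pos[of k], of "z (Suc k)"] inc[of k] that by simp
    qed (use assms sgn in auto)
    also have "\<dots> \<le> (\<Sum>k=1..m. d powr (-a))"
    proof (rule sum_mono)
      fix k assume k: "k \<in> {1..m}"
      show "(if s k = 1 \<and> s (k - 1) = 1 then z k powr (-a) else 0) \<le> d powr (-a)"
      proof (cases "s k = 1 \<and> s (k - 1) = 1")
        case True
        hence "d \<le> z k"
          using sep[of "k - 1"] nonneg[of "k - 1"] k by (cases k) auto
        with True show ?thesis using powr_neg_antimono[OF \<open>a > 0\<close> \<open>d > 0\<close>, of "z k"] by simp
      qed auto
    qed
    finally show ?thesis by simp
  qed
  let ?h = "\<lambda>u. u powr (-a) - (u + d) powr (-a)"
  have anti: "?h v \<le> ?h u" if "0 < u" "u \<le> v" for u v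
    using powr_neg_diff_antimono[of a d u v] that assms by simp
  let ?S = "\<lambda>l. \<Sum>k=1..l. if s k = 1 \<and> s (k - 1) = 1 then ?h (z k) else 0"
  \<comment> \<open>The witness \<open>g\<close> counts the surviving terms up to \<open>l\<close>.
    Each survivor moves \<open>z\<close> outwards by at least \<open>d\<close> and extends the
    telescoping sum by one step of length \<open>d\<close>.\<close>
  have "\<exists>g\<le>l. real g * d \<le> z l \<and> ?S l \<le> d powr (-a) - (real (Suc g) * d) powr (-a)" if "l \<le> m" for l
    using that
  proof (induction l)
    case 0
    show ?case using \<open>z 0 = 0\<close> by auto
  next
    case (Suc l)
    then obtain g where g: "g \<le> l" "real g * d \<le> z l"
        "?S l \<le> d powr (-a) - (real (Suc g) * d) powr (-a)" by auto
    show ?case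
    proof (cases "s (Suc l) = 1 \<and> s l = 1")
      case True
      have le: "real (Suc g) * d \<le> z (Suc l)"
        using g(2) sep[OF Suc.prems] True by (simp add: algebra_simps)
      have "?h (z (Suc l)) \<le> ?h (real (Suc g) * d)"
        using le \<open>d > 0\<close> by (intro anti) auto
      also have "\<dots> = (real (Suc g) * d) powr (-a) - (real (Suc (Suc g)) * d) powr (-a)"
        by (simp add: algebra_simps)
      finally have "?S (Suc l) \<le> d powr (-a) - (real (Suc (Suc g)) * d) powr (-a)"
        using True g(3) by simp
      with le g(1) show ?thesis by (intro exI[of _ "Suc g"]) auto
    next
      case False
      with g inc[OF Suc.prems] show ?thesis by (intro exI[of _ g]) auto
    qed
  qed
  from this[of m] obtain g where g: "g \<le> m" "?S m \<le> d powr (-a) - (real (Suc g) * d) powr (-a)"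
    by auto
  have "(\<Sum>k=1..m. s k * ?h (z k)) \<le> ?S m"
  proof (rule signed_sum_le_sum_repeated_signs)
    show "?h (z (Suc k)) \<le> ?h (z k)" if "1 \<le> k" "Suc k \<le> m" for k
      using inc[of k] pos[of k] that by (intro anti) auto
    show "0 \<le> ?h (z k)" if "1 \<le> k" "k \<le> m" for k
      using powr_neg_antimono[OF \<open>a > 0\<close> pos[of k], of "z k + d"] that \<open>d > 0\<close> by simp
  qed (use assms sgn in auto)
  also note g(2)
  also have "(real (Suc m) * d) powr (-a) \<le> (real (Suc g) * d) powr (-a)"
    using g(1) \<open>d > 0\<close> \<open>a > 0\<close> by (intro powr_neg_antimono) auto
  hence "d powr (-a) - (real (Suc g) * d) powr (-a) \<le> d powr (-a) - (real (Suc m) * d) powr (-a)"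
    by simp
  finally show "(\<Sum>k=1..m. s k * ?h (z k)) \<le> d powr (-a) - (real (Suc m) * d) powr (-a)" .
qed

section \<open>First crossing times and comparison on an interval\<close>

text \<open>The times at which some \<open>u p\<close> is at most \<open>\<delta>\<close> form a
  compact set, and \<open>t\<close> is its least element. By the intermediate value theorem, a
  function strictly below \<open>\<delta>\<close> at \<open>t\<close> would have crossed
  \<open>\<delta>\<close> earlier.\<close>

lemma first_crossing_time:
  fixes u :: "'p \<Rightarrow> real \<Rightarrow> real"
  assumes "finite P" "\<And>p. p \<in> P \<Longrightarrow> continuous_on {\<sigma>..t1} (u p)"
    and "\<And>p. p \<in> P \<Longrightarrow> u p \<sigma> > \<delta>" and "p1 \<in> P" "u p1 t1 \<le> \<delta>" "\<sigma> \<le> t1"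
  obtains t p where "\<sigma> < t" "t \<le> t1" "p \<in> P" "u p t = \<delta>" "\<And>q. q \<in> P \<Longrightarrow> \<delta> \<le> u q t"
    "\<And>r. \<sigma> \<le> r \<Longrightarrow> r < t \<Longrightarrow> \<delta> < u p r"
proof -
  define S where "S = (\<Union>p\<in>P. {\<sigma>..t1} \<inter> u p -` {..\<delta>})"
  have "compact ({\<sigma>..t1} \<inter> u p -` {..\<delta>})" if "p \<in> P" for p
    using continuous_closed_preimage[OF assms(2)[OF that], of "{..\<delta>}"]
    by (simp add: compact_eq_bounded_closed bounded_Int)
  hence "compact S" unfolding S_def using assms(1) by (intro compact_UN) auto
  moreover have "t1 \<in> S" unfolding S_def using assms(4-6) by (intro UN_I[of p1]) auto
  hence "S \<noteq> {}" by blast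
  ultimately obtain t where t: "t \<in> S" "\<And>r. r \<in> S \<Longrightarrow> t \<le> r"
    by (meson compact_attains_inf)
  then obtain p where p: "p \<in> P" "\<sigma> \<le> t" "t \<le> t1" "u p t \<le> \<delta>"
    unfolding S_def by auto
  have "t \<noteq> \<sigma>" using p assms(3)[of p] by auto
  have ge: "\<delta> \<le> u q t" if q: "q \<in> P" for q
  proof (rule ccontr)
    assume neg: "\<not> \<delta> \<le> u q t"
    have "continuous_on {\<sigma>..t} (u q)"
      using assms(2)[OF q] by (rule continuous_on_subset) (use p in auto)
    then obtain r where r: "\<sigma> \<le> r" "r \<le> t" "u q r = \<delta>"
      using IVT2'[of "u q" t \<delta> \<sigma>] neg p assms(3)[OF q] by auto
    hence "r \<in> S" unfolding S_def using q p by auto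
    with t(2) r neg show False by force
  qed
  have "\<delta> < u p r" if "\<sigma> \<le> r" "r < t" for r
    using t(2)[of r] that p unfolding S_def by force
  with ge p \<open>t \<noteq> \<sigma>\<close> that[of t p] show ?thesis by force
qed

text \<open>The derivative is needed only on the open interval, so \<open>t\<close> may be a
  collision time, where trajectories are merely continuous.\<close>

lemma ge_of_derivative_ge:
  fixes u :: "real \<Rightarrow> real"
  assumes "s \<le> t" "continuous_on {s..t} u"
    and "\<And>r. s < r \<Longrightarrow> r < t \<Longrightarrow> \<exists>v. (u has_real_derivative v) (at r) \<and> - A \<le> v"
  shows "u s - A * (t - s) \<le> u t"
proof -
  have "u s + A * s \<le> u t + A * t"
  proof (rule DERIV_nonneg_imp_increasing_open[OF assms(1)])
    fix r assume "s < r" "r < t"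
    then obtain v where "(u has_real_derivative v) (at r)" "- A \<le> v" using assms(3) by blast
    then show "\<exists>y. ((\<lambda>r. u r + A * r) has_real_derivative y) (at r) \<and> 0 \<le> y"
      by (intro exI[of _ "v + A"]) (auto intro!: derivative_eq_intros)
  qed (use assms(2) in \<open>auto intro!: continuous_intros\<close>)
  then show ?thesis by (simp add: algebra_simps)
qed

lemma strict_increasing_lessThan:
  fixes Y :: "nat \<Rightarrow> real"
  assumes "\<And>i. Suc i < m \<Longrightarrow> Y i < Y (Suc i)" "i < j" "j < m"
  shows "Y i < Y j"
  using assms(2,3)
proof (induction j)
  case (Suc j)
  then show ?case using assms(1)[of j] by (cases "i = j") auto
qed simp

section \<open>Interaction sums acting on one particle\<close>

text \<open>The first sum is the push to the left that particle \<open>p\<close> receives from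
  everything on its right; it is bounded from above only, since attraction is not controlled here.
  The second compares this push with the one at a point at distance \<open>d\<close> to the left of
  \<open>p\<close>. Both follow by passing to signs and distances relative to
  \<open>p\<close>.\<close>

lemma right_interaction_le:
  fixes c Y :: "nat \<Rightarrow> real" and a d :: real
  assumes "a > 0" "d > 0" "p < m"
    and sgn: "\<And>i. i < m \<Longrightarrow> c i \<in> {-1, 1}"
    and inc: "\<And>i. Suc i < m \<Longrightarrow> Y i < Y (Suc i)"
    and sep: "\<And>i. \<lbrakk>Suc i < m; c i = c (Suc i)\<rbrakk> \<Longrightarrow> d \<le> Y (Suc i) - Y i"
  shows "(\<Sum>j\<in>{p<..<m}. c p * c j * (Y j - Y p) powr (-a)) \<le> real m * d powr (-a)"
    and "(\<Sum>j\<in>{p<..<m}. c p * c j * ((Y j - Y p) powr (-a) - (Y j - Y p + d) powr (-a)))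
           \<le> d powr (-a) - (real m * d) powr (-a)"
proof -
  define s where "s k = c p * c (p + k)" for k
  define z where "z k = Y (p + k) - Y p" for k
  define l where "l = m - 1 - p"
  have reindex: "(\<Sum>j\<in>{p<..<m}. \<phi> j) = (\<Sum>k=1..l. \<phi> (p + k))" for \<phi> :: "nat \<Rightarrow> real"
    unfolding l_def
    by (rule sum.reindex_bij_witness[of _ "\<lambda>k. p + k" "\<lambda>j. j - p"]) auto
  have lm: "k \<le> l \<Longrightarrow> p + k < m" for k using \<open>p < m\<close> unfolding l_def by auto
  have cp: "c p = 1 \<or> c p = -1" using sgn[OF \<open>p < m\<close>] by auto
  have *: "s 0 = 1" "z 0 = 0" "\<And>k. k \<le> l \<Longrightarrow> s k \<in> {-1, 1}"
      "\<And>k. Suc k \<le> l \<Longrightarrow> z k < z (Suc k)"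
      "\<And>k. \<lbrakk>Suc k \<le> l; s k = s (Suc k)\<rbrakk> \<Longrightarrow> d \<le> z (Suc k) - z k"
  proof -
    show "s k \<in> {-1, 1}" if "k \<le> l" for k
      using cp sgn[OF lm[OF that]] unfolding s_def by auto
    show "z k < z (Suc k)" if "Suc k \<le> l" for k
      using inc[of "p + k"] lm[OF that] unfolding z_def by simp
    show "d \<le> z (Suc k) - z k" if "Suc k \<le> l" "s k = s (Suc k)" for k
      using sep[of "p + k"] lm[OF that(1)] cp that(2) unfolding z_def s_def by auto
  qed (use cp in \<open>auto simp: s_def z_def\<close>)
  note bounds = signed_potential_sum_le[of a d s z l, OF assms(1,2) *]
  have "real l * d powr (-a) \<le> real m * d powr (-a)"
    unfolding l_def by (intro mult_right_mono) auto
  with bounds(1) show "(\<Sum>j\<in>{p<..<m}. c p * c j * (Y j - Y p) powr (-a)) \<le> real m * d powr (-a)"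
    unfolding reindex s_def z_def by linarith
  have "(real m * d) powr (-a) \<le> (real (Suc l) * d) powr (-a)"
    using assms(1-3) unfolding l_def by (intro powr_neg_antimono mult_right_mono) auto
  with bounds(2)
  show "(\<Sum>j\<in>{p<..<m}. c p * c j * ((Y j - Y p) powr (-a) - (Y j - Y p + d) powr (-a)))
           \<le> d powr (-a) - (real m * d) powr (-a)"
    unfolding reindex s_def z_def by linarith
qed

text \<open>Reflecting the line and reversing the numbering turns the left neighbours into right
  neighbours.\<close>

lemma left_interaction_le:
  fixes c Y :: "nat \<Rightarrow> real" and a d :: real
  assumes "a > 0" "d > 0" "p < m"
    and sgn: "\<And>i. i < m \<Longrightarrow> c i \<in> {-1, 1}"
    and inc: "\<And>i. Suc i < m \<Longrightarrow> Y i < Y (Suc i)"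
    and sep: "\<And>i. \<lbrakk>Suc i < m; c i = c (Suc i)\<rbrakk> \<Longrightarrow> d \<le> Y (Suc i) - Y i"
  shows "(\<Sum>j<p. c p * c j * (Y p - Y j) powr (-a)) \<le> real m * d powr (-a)"
    and "(\<Sum>j<p. c p * c j * ((Y p - Y j) powr (-a) - (Y p - Y j + d) powr (-a)))
           \<le> d powr (-a) - (real m * d) powr (-a)"
proof -
  define q where "q = m - 1 - p"
  define c' where "c' i = c (m - 1 - i)" for i
  define Y' where "Y' i = - Y (m - 1 - i)" for i
  have q: "q < m" "m - 1 - q = p" using \<open>p < m\<close> unfolding q_def by auto
  have Suc: "m - 1 - i = Suc (m - 1 - Suc i)" if "Suc i < m" for i using that by auto
  have *: "\<And>i. i < m \<Longrightarrow> c' i \<in> {-1, 1}"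
      "\<And>i. Suc i < m \<Longrightarrow> Y' i < Y' (Suc i)"
      "\<And>i. \<lbrakk>Suc i < m; c' i = c' (Suc i)\<rbrakk> \<Longrightarrow> d \<le> Y' (Suc i) - Y' i"
  proof -
    show "c' i \<in> {-1, 1}" if "i < m" for i
      unfolding c'_def by (rule sgn) (use that in auto)
    show "Y' i < Y' (Suc i)" if "Suc i < m" for i
      using inc[of "m - 1 - Suc i"] Suc[OF that] that unfolding Y'_def by simp
    show "d \<le> Y' (Suc i) - Y' i" if "Suc i < m" "c' i = c' (Suc i)" for i
      using sep[of "m - 1 - Suc i"] Suc[OF that(1)] that unfolding Y'_def c'_def by simp
  qed
  have reindex: "(\<Sum>j<p. \<phi> j) = (\<Sum>j\<in>{q<..<m}. \<phi> (m - 1 - j))" for \<phi> :: "nat \<Rightarrow> real"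
    using \<open>p < m\<close> unfolding q_def
    by (intro sum.reindex_bij_witness[of _ "\<lambda>j. m - 1 - j" "\<lambda>j. m - 1 - j"]) auto
  note bounds = right_interaction_le[of a d q m c' Y', OF assms(1,2) q(1) *]
  show "(\<Sum>j<p. c p * c j * (Y p - Y j) powr (-a)) \<le> real m * d powr (-a)"
    using bounds(1) unfolding reindex c'_def Y'_def q(2) by simp
  show "(\<Sum>j<p. c p * c j * ((Y p - Y j) powr (-a) - (Y p - Y j + d) powr (-a)))
           \<le> d powr (-a) - (real m * d) powr (-a)"
    using bounds(2) unfolding reindex c'_def Y'_def q(2) by simp
qed

section \<open>Hoelder estimate from one-sided velocity bounds\<close>

text \<open>Signs no longer appear: what is retained is that the speed to the left is singular only
  in the gap on the left, and the speed to the right only in the gap on the right. Gaps are strictly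
  positive only before \<open>\<tau>\<close>, which allows a collision at
  \<open>\<tau>\<close>.\<close>

locale gap_controlled =
  fixes m :: nat and y v :: "nat \<Rightarrow> real \<Rightarrow> real" and \<sigma> \<tau> a B N W :: real
  assumes exponent: "a > 0" and interval: "\<sigma> < \<tau>"
    and const_nonneg: "B \<ge> 0" "N \<ge> 0" "W \<ge> 0"
    and cont: "i < m \<Longrightarrow> continuous_on {\<sigma>..\<tau>} (y i)"
    and deriv: "\<lbrakk>i < m; \<sigma> < t; t < \<tau>\<rbrakk> \<Longrightarrow> (y i has_real_derivative v i t) (at t)"
    and gap_pos: "\<lbrakk>Suc i < m; \<sigma> \<le> t; t < \<tau>\<rbrakk> \<Longrightarrow> y i t < y (Suc i) t"
    and gap_le: "\<lbrakk>Suc i < m; \<sigma> \<le> t; t \<le> \<tau>\<rbrakk> \<Longrightarrow> y (Suc i) t - y i t \<le> W"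
    and vel_first: "\<lbrakk>0 < m; \<sigma> < t; t < \<tau>\<rbrakk> \<Longrightarrow> - B \<le> v 0 t"
    and vel_last: "\<lbrakk>0 < m; \<sigma> < t; t < \<tau>\<rbrakk> \<Longrightarrow> v (m - 1) t \<le> B"
    and vel_ge: "\<lbrakk>Suc i < m; \<sigma> < t; t < \<tau>\<rbrakk> \<Longrightarrow>
          - (N * (y (Suc i) t - y i t) powr (-a)) - B \<le> v (Suc i) t"
    and vel_le: "\<lbrakk>Suc i < m; \<sigma> < t; t < \<tau>\<rbrakk> \<Longrightarrow>
          v i t \<le> N * (y (Suc i) t - y i t) powr (-a) + B"
begin

lemma gap_nonneg:
  assumes "Suc i < m" "\<sigma> \<le> t" "t \<le> \<tau>"
  shows "y i t \<le> y (Suc i) t"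
proof (cases "t = \<tau>")
  case True
  have "(y i \<longlongrightarrow> y i \<tau>) (at \<tau> within {\<sigma>..\<tau>})" "(y (Suc i) \<longlongrightarrow> y (Suc i) \<tau>) (at \<tau> within {\<sigma>..\<tau>})"
    using cont[of i] cont[of "Suc i"] assms interval unfolding continuous_on_def by auto
  hence lim: "(y i \<longlongrightarrow> y i \<tau>) (at_left \<tau>)" "(y (Suc i) \<longlongrightarrow> y (Suc i) \<tau>) (at_left \<tau>)"
    using interval by (simp_all add: at_within_Icc_at_left)
  have "\<forall>\<^sub>F r in at_left \<tau>. y i r \<le> y (Suc i) r"
    using eventually_at_left_real[OF interval]
    by eventually_elim (use gap_pos[OF assms(1)] in \<open>auto intro: less_imp_le\<close>)
  from tendsto_le[OF _ lim(2,1) this] show ?thesis using True by simp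
qed (use gap_pos[OF assms(1,2)] assms in force)

text \<open>The largest rate at which a gap raised to the power \<open>1 + a\<close> can decrease:
  the singular part of the velocity bounds contributes \<open>N\<close>, and the bounded part is
  estimated by means of the largest gap \<open>W\<close>.\<close>

definition "decay = 2 * (1 + a) * (N + B * W powr a)"

lemma decay_nonneg: "decay \<ge> 0"
  unfolding decay_def using exponent const_nonneg by simp

text \<open>The derivative of the power carries the factor \<open>D powr a\<close>, which cancels
  the singularity \<open>D powr (-a)\<close> in the velocity bounds.\<close>

lemma gap_decay:
  assumes i: "Suc i < m" and "\<sigma> \<le> s" "s \<le> t" "t \<le> \<tau>"
  shows "(y (Suc i) s - y i s) powr (1 + a) - decay * (t - s) \<le> (y (Suc i) t - y i t) powr (1 + a)"
proof (rule ge_of_derivative_ge[OF \<open>s \<le> t\<close>])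
  have "continuous_on {s..t} (y (Suc i))" "continuous_on {s..t} (y i)"
    using i assms by (auto intro!: continuous_on_subset[OF cont])
  then show "continuous_on {s..t} (\<lambda>r. (y (Suc i) r - y i r) powr (1 + a))"
    using gap_nonneg[OF i] assms exponent
    by (intro continuous_on_powr' continuous_intros) auto
  fix r assume r: "s < r" "r < t"
  define D where "D = y (Suc i) r - y i r"
  have D: "D > 0" "D \<le> W" using gap_pos[OF i, of r] gap_le[OF i, of r] r assms unfolding D_def by auto
  have "((\<lambda>r. (y (Suc i) r - y i r) powr (1 + a)) has_real_derivative
          (1 + a) * D powr a * (v (Suc i) r - v i r)) (at r)"
    using DERIV_fun_powr[OF DERIV_diff[OF deriv[of "Suc i" r] deriv[of i r]], of "1 + a"]
      i r assms D(1) unfolding D_def by simp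
  moreover have "- decay \<le> (1 + a) * D powr a * (v (Suc i) r - v i r)"
  proof -
    have "- (2 * (N * D powr (-a) + B)) \<le> v (Suc i) r - v i r"
      using vel_ge[OF i, of r] vel_le[OF i, of r] r assms unfolding D_def by simp
    hence "D powr a * - (2 * (N * D powr (-a) + B)) \<le> D powr a * (v (Suc i) r - v i r)"
      by (intro mult_left_mono) auto
    moreover have "D powr a * D powr (-a) = 1" using D(1) by (simp flip: powr_add)
    moreover have "B * D powr a \<le> B * W powr a"
      using D exponent const_nonneg by (intro mult_left_mono powr_mono2) auto
    ultimately have "- (2 * (N + B * W powr a)) \<le> D powr a * (v (Suc i) r - v i r)"
      by (simp add: algebra_simps)
    hence "(1 + a) * - (2 * (N + B * W powr a)) \<le> (1 + a) * (D powr a * (v (Suc i) r - v i r))"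
      using exponent by (intro mult_left_mono) auto
    then show ?thesis unfolding decay_def by (simp add: algebra_simps)
  qed
  ultimately show "\<exists>w. ((\<lambda>r. (y (Suc i) r - y i r) powr (1 + a)) has_real_derivative w) (at r) \<and> - decay \<le> w"
    by blast
qed

text \<open>
  If the gap to the left neighbour is initially large on the scale \<open>r = (t - s) powr (1 / (1 + a))\<close>,
  it stays at least \<open>r\<close> up to time \<open>t\<close>, which bounds the speed to the left. Otherwise the left
  neighbour acts as a barrier.
\<close>
lemma displacement_ge:
  obtains K where "K \<ge> 0"
    "\<And>i s t. \<lbrakk>i < m; \<sigma> \<le> s; s \<le> t; t \<le> \<tau>\<rbrakk> \<Longrightarrow> y i s - K * (t - s) powr (1 / (1 + a)) \<le> y i t"
proof -
  \<comment> \<open>Moving left with speed at most \<open>N * r powr (-a) + B\<close> during a time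
    \<open>r powr (1 + a)\<close> costs at most \<open>K0 * r\<close>. The power of
    \<open>\<tau> - \<sigma>\<close> bounds \<open>r powr a\<close>.\<close>
  define K0 where "K0 = N + B * (\<tau> - \<sigma>) powr (a / (1 + a))"
  \<comment> \<open>With this \<open>M\<close>, the power \<open>1 + a\<close> of a gap
    \<open>M * r\<close> is \<open>(decay + 1) * (t - s)\<close>. At most
    \<open>decay * (t - s)\<close> of it is lost up to time \<open>t\<close>, so the gap stays at
    least \<open>r\<close>.\<close>
  define M where "M = (decay + 1) powr (1 / (1 + a))"
  have M: "M powr (1 + a) = decay + 1" "M \<ge> 0"
    unfolding M_def using decay_nonneg exponent by (simp_all add: powr_powr)
  have K0: "K0 \<ge> 0" unfolding K0_def using const_nonneg by simp
  have main: "y i s - (K0 + real i * M) * (t - s) powr (1 / (1 + a)) \<le> y i t"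
    if "i < m" "\<sigma> \<le> s" "s < t" "t \<le> \<tau>" for i s t
  proof -
    define r where "r = (t - s) powr (1 / (1 + a))"
    have r: "r > 0" "r powr (1 + a) = t - s"
      unfolding r_def using that exponent by (simp_all add: powr_powr)
    have speed: "(N * r powr (-a) + B) * (t - s) \<le> K0 * r"
    proof -
      have "r powr (-a) * (t - s) = r"
        unfolding r(2)[symmetric] using r(1) by (simp flip: powr_add)
      moreover have "t - s = r powr a * r"
        unfolding r(2)[symmetric] using r(1) by (simp add: powr_add)
      moreover have "r powr a \<le> (\<tau> - \<sigma>) powr (a / (1 + a))"
        unfolding r_def powr_powr using that exponent by (simp add: powr_mono2)
      hence "B * (r powr a * r) \<le> B * ((\<tau> - \<sigma>) powr (a / (1 + a)) * r)"
        using r const_nonneg by (intro mult_left_mono mult_right_mono) auto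
      ultimately show ?thesis
        unfolding K0_def by (metis (no_types, lifting) add_left_mono distrib_right mult.assoc)
    qed
    have free: "y i s - K0 * r \<le> y i t"
      if i: "i < m" and vel: "\<And>u. \<lbrakk>s < u; u < t\<rbrakk> \<Longrightarrow> - (N * r powr (-a) + B) \<le> v i u" for i
    proof -
      have "y i s - (N * r powr (-a) + B) * (t - s) \<le> y i t"
      proof (rule ge_of_derivative_ge)
        show "continuous_on {s..t} (y i)"
          using \<open>\<sigma> \<le> s\<close> \<open>t \<le> \<tau>\<close> by (auto intro!: continuous_on_subset[OF cont[OF i]])
        fix u assume u: "s < u" "u < t"
        show "\<exists>w. (y i has_real_derivative w) (at u) \<and> - (N * r powr (-a) + B) \<le> w"
          using deriv[OF i, of u] vel[OF u] u \<open>\<sigma> \<le> s\<close> \<open>t \<le> \<tau>\<close> by auto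
      qed (use \<open>s < t\<close> in auto)
      with speed show ?thesis by linarith
    qed
    \<comment> \<open>The constant grows by \<open>M\<close> with each index: a particle confined by
      its left neighbour starts less than \<open>M * r\<close> to the right of it and inherits its
      bound.\<close>
    have "y i s - (K0 + real i * M) * r \<le> y i t"
      using \<open>i < m\<close>
    proof (induction i)
      case 0
      have "- (N * r powr (-a) + B) \<le> v 0 u" if "s < u" "u < t" for u
        using vel_first[OF 0, of u] that \<open>\<sigma> \<le> s\<close> \<open>t \<le> \<tau>\<close> const_nonneg
        by (smt (verit) mult_nonneg_nonneg powr_ge_zero)
      from free[OF 0 this] show ?case by simp
    next
      case (Suc i)
      have IH: "y i s - (K0 + real i * M) * r \<le> y i t" using Suc by simp
      show ?case
      proof (cases "M * r \<le> y (Suc i) s - y i s")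
        case True
        have "- (N * r powr (-a) + B) \<le> v (Suc i) u" if u: "s < u" "u < t" for u
        proof -
          have "(decay + 1) * (t - s) = (M * r) powr (1 + a)"
            using M r by (simp add: powr_mult)
          also have "\<dots> \<le> (y (Suc i) s - y i s) powr (1 + a)"
            using True M r exponent by (intro powr_mono2) auto
          also have "\<dots> \<le> (y (Suc i) u - y i u) powr (1 + a) + decay * (u - s)"
            using gap_decay[OF Suc.prems, of s u] u \<open>\<sigma> \<le> s\<close> \<open>t \<le> \<tau>\<close> by simp
          also have "decay * (u - s) \<le> decay * (t - s)"
            using u decay_nonneg by (intro mult_left_mono) auto
          finally have "r powr (1 + a) \<le> (y (Suc i) u - y i u) powr (1 + a)"
            using r by (simp add: algebra_simps)
          hence "r \<le> y (Suc i) u - y i u"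
            using powr_less_mono2[of "1 + a" "y (Suc i) u - y i u" r] exponent
              gap_pos[OF Suc.prems, of u] u \<open>\<sigma> \<le> s\<close> \<open>t \<le> \<tau>\<close> by force
          hence "(y (Suc i) u - y i u) powr (-a) \<le> r powr (-a)"
            using r exponent by (intro powr_neg_antimono) auto
          hence "N * (y (Suc i) u - y i u) powr (-a) \<le> N * r powr (-a)"
            using const_nonneg by (intro mult_left_mono)
          with vel_ge[OF Suc.prems, of u] u \<open>\<sigma> \<le> s\<close> \<open>t \<le> \<tau>\<close> show ?thesis by simp
        qed
        from free[OF Suc.prems this] have "y (Suc i) s - K0 * r \<le> y (Suc i) t" .
        moreover have "0 \<le> real (Suc i) * M * r" using M r by simp
        ultimately show ?thesis by (simp add: algebra_simps)
      next
        case False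
        with IH gap_nonneg[OF Suc.prems, of t] that show ?thesis by (simp add: algebra_simps)
      qed
    qed
    then show ?thesis unfolding r_def .
  qed
  show ?thesis
  proof (rule that[of "K0 + real m * M"])
    show "0 \<le> K0 + real m * M" using K0 M by simp
    fix i s t assume *: "i < m" "\<sigma> \<le> s" "s \<le> t" "t \<le> \<tau>"
    have "(K0 + real i * M) * (t - s) powr (1 / (1 + a)) \<le> (K0 + real m * M) * (t - s) powr (1 / (1 + a))"
      using * M by (intro mult_right_mono add_left_mono) auto
    with main[OF *(1,2) _ *(4)] *(3)
    show "y i s - (K0 + real m * M) * (t - s) powr (1 / (1 + a)) \<le> y i t"
      by (cases "s = t") (simp, linarith)
  qed
qed

text \<open>The hypotheses are symmetric under reflection of the line with reversed numbering, so a
  bound on displacement to the left also yields one to the right.\<close>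

lemma mirror: "gap_controlled m (\<lambda>i t. - y (m - 1 - i) t) (\<lambda>i t. - v (m - 1 - i) t) \<sigma> \<tau> a B N W"
proof
  have Suc: "m - 1 - i = Suc (m - 1 - Suc i)" "Suc (m - 1 - Suc i) < m" if "Suc i < m" for i
    using that by auto
  fix i t
  show "continuous_on {\<sigma>..\<tau>} (\<lambda>t. - y (m - 1 - i) t)" if "i < m"
    using that by (intro continuous_intros cont) auto
  show "((\<lambda>t. - y (m - 1 - i) t) has_real_derivative - v (m - 1 - i) t) (at t)"
    if "i < m" "\<sigma> < t" "t < \<tau>"
    using that by (intro derivative_intros deriv) auto
  show "- y (m - 1 - i) t < - y (m - 1 - Suc i) t" if "Suc i < m" "\<sigma> \<le> t" "t < \<tau>"
    using gap_pos[OF Suc(2)[OF that(1)] that(2,3)] Suc(1)[OF that(1)] by simp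
  show "- y (m - 1 - Suc i) t - - y (m - 1 - i) t \<le> W" if "Suc i < m" "\<sigma> \<le> t" "t \<le> \<tau>"
    using gap_le[OF Suc(2)[OF that(1)] that(2,3)] Suc(1)[OF that(1)] by simp
  show "- B \<le> - v (m - 1 - 0) t" if "0 < m" "\<sigma> < t" "t < \<tau>"
    using vel_last[OF that] by simp
  show "- v (m - 1 - (m - 1)) t \<le> B" if "0 < m" "\<sigma> < t" "t < \<tau>"
    using vel_first[OF that] by simp
  show "- (N * (- y (m - 1 - Suc i) t - - y (m - 1 - i) t) powr (-a)) - B \<le> - v (m - 1 - Suc i) t"
    if "Suc i < m" "\<sigma> < t" "t < \<tau>"
    using vel_le[OF Suc(2)[OF that(1)] that(2,3)] Suc(1)[OF that(1)] by simp
  show "- v (m - 1 - i) t \<le> N * (- y (m - 1 - Suc i) t - - y (m - 1 - i) t) powr (-a) + B"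
    if "Suc i < m" "\<sigma> < t" "t < \<tau>"
    using vel_ge[OF Suc(2)[OF that(1)] that(2,3)] Suc(1)[OF that(1)] by simp
qed (use exponent interval const_nonneg in auto)

lemma holder:
  assumes "i < m"
  shows "holder_continuous_on (1 / (1 + a)) {\<sigma>..\<tau>} (y i)"
proof -
  obtain K where K: "K \<ge> 0"
    "\<And>i s t. \<lbrakk>i < m; \<sigma> \<le> s; s \<le> t; t \<le> \<tau>\<rbrakk> \<Longrightarrow> y i s - K * (t - s) powr (1 / (1 + a)) \<le> y i t"
    using displacement_ge by blast
  interpret mirrored: gap_controlled m "\<lambda>i t. - y (m - 1 - i) t" "\<lambda>i t. - v (m - 1 - i) t" \<sigma> \<tau> a B N W
    by (rule mirror)
  obtain K' where K': "K' \<ge> 0"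
    "\<And>i s t. \<lbrakk>i < m; \<sigma> \<le> s; s \<le> t; t \<le> \<tau>\<rbrakk> \<Longrightarrow>
       - y (m - 1 - i) s - K' * (t - s) powr (1 / (1 + a)) \<le> - y (m - 1 - i) t"
    using mirrored.displacement_ge by blast
  have *: "\<bar>y i s - y i t\<bar> \<le> (K + K') * (t - s) powr (1 / (1 + a))"
    if "\<sigma> \<le> s" "s \<le> t" "t \<le> \<tau>" for s t
  proof -
    have "m - 1 - i < m" "m - 1 - (m - 1 - i) = i" using assms by auto
    with K(2)[OF assms that] K'(2)[of "m - 1 - i", OF _ that]
    have "y i s - K * (t - s) powr (1 / (1 + a)) \<le> y i t"
         "y i t \<le> y i s + K' * (t - s) powr (1 / (1 + a))" by auto
    moreover have "0 \<le> K * (t - s) powr (1 / (1 + a))" "0 \<le> K' * (t - s) powr (1 / (1 + a))"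
      using K(1) K'(1) by auto
    ultimately show ?thesis by (simp add: algebra_simps)
  qed
  show ?thesis
    unfolding holder_continuous_on_def
  proof (intro exI[of _ "K + K'"] conjI ballI)
    fix s t assume "s \<in> {\<sigma>..\<tau>}" "t \<in> {\<sigma>..\<tau>}"
    then show "\<bar>y i s - y i t\<bar> \<le> (K + K') * \<bar>s - t\<bar> powr (1 / (1 + a))"
      using *[of s t] *[of t s] by (cases "s \<le> t") (auto simp: abs_minus_commute)
  qed (use K K' in auto)
qed

end

section \<open>Same-sign gaps in the power-law system\<close>

text \<open>Particles are numbered from left to right and interact by the pure power law. The
  regular part of the force and the external field enter only through the error
  \<open>C\<close>.\<close>

locale ordered_particles =
  fixes m :: nat and c :: "nat \<Rightarrow> real" and y v :: "nat \<Rightarrow> real \<Rightarrow> real" and \<sigma> \<tau> a C W :: real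
  assumes exponent: "a > 0" and interval: "\<sigma> < \<tau>"
    and const_nonneg: "C \<ge> 0" "W \<ge> 0"
    and sgn: "i < m \<Longrightarrow> c i \<in> {-1, 1}"
    and cont: "i < m \<Longrightarrow> continuous_on {\<sigma>..\<tau>} (y i)"
    and deriv: "\<lbrakk>i < m; \<sigma> < t; t < \<tau>\<rbrakk> \<Longrightarrow> (y i has_real_derivative v i t) (at t)"
    and gap_pos: "\<lbrakk>Suc i < m; \<sigma> \<le> t; t < \<tau>\<rbrakk> \<Longrightarrow> y i t < y (Suc i) t"
    and gap_le: "\<lbrakk>Suc i < m; \<sigma> \<le> t; t \<le> \<tau>\<rbrakk> \<Longrightarrow> y (Suc i) t - y i t \<le> W"
    and velocity: "\<lbrakk>i < m; \<sigma> < t; t < \<tau>\<rbrakk> \<Longrightarrow>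
          \<bar>v i t - ((\<Sum>j<i. c i * c j * (y i t - y j t) powr (-a)) -
                  (\<Sum>j\<in>{i<..<m}. c i * c j * (y j t - y i t) powr (-a)))\<bar> \<le> C"
begin

lemma sgn_square: "i < m \<Longrightarrow> c i * c i = 1"
  using sgn[of i] by auto

text \<open>The two particles repel each other, which contributes \<open>2 * d powr (-a)\<close>.
  The particles on either side compress the pair by at most
  \<open>d powr (-a) - (real m * d) powr (-a)\<close> per side, so a positive remainder is left
  over.\<close>

lemma same_sign_gap_growth:
  assumes i: "Suc i < m" "c i = c (Suc i)" and t: "\<sigma> < t" "t < \<tau>"
    and d: "d = y (Suc i) t - y i t"
    and sep: "\<And>j. \<lbrakk>Suc j < m; c j = c (Suc j)\<rbrakk> \<Longrightarrow> d \<le> y (Suc j) t - y j t"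
  shows "2 * (real m * d) powr (-a) - 2 * C \<le> v (Suc i) t - v i t"
proof -
  let ?Y = "\<lambda>j. y j t"
  have "d > 0" using gap_pos[OF i(1), of t] t d by simp
  \<comment> \<open>\<open>Ri\<close> and \<open>Li\<close> are evaluated at the particle of the
    pair nearer to the side in question, \<open>Ro\<close> and \<open>Lo\<close> at the farther one.
    Only the differences \<open>Ri - Ro\<close> and \<open>Li - Lo\<close> affect the gap.\<close>
  define Ri where "Ri = (\<Sum>j\<in>{Suc i<..<m}. c i * c j * (?Y j - ?Y (Suc i)) powr (-a))"
  define Ro where "Ro = (\<Sum>j\<in>{Suc i<..<m}. c i * c j * (?Y j - ?Y i) powr (-a))"
  define Li where "Li = (\<Sum>j<i. c i * c j * (?Y i - ?Y j) powr (-a))"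
  define Lo where "Lo = (\<Sum>j<i. c i * c j * (?Y (Suc i) - ?Y j) powr (-a))"
  have "(\<Sum>j\<in>{Suc i<..<m}. c (Suc i) * c j *
            ((?Y j - ?Y (Suc i)) powr (-a) - (?Y j - ?Y (Suc i) + d) powr (-a)))
          \<le> d powr (-a) - (real m * d) powr (-a)"
    by (rule right_interaction_le(2)) (use exponent \<open>d > 0\<close> i sgn gap_pos sep t in auto)
  hence right: "Ri - Ro \<le> d powr (-a) - (real m * d) powr (-a)"
    unfolding Ri_def Ro_def sum_subtractf[symmetric] i(2)[symmetric] d by (simp add: algebra_simps)
  have "(\<Sum>j<i. c i * c j * ((?Y i - ?Y j) powr (-a) - (?Y i - ?Y j + d) powr (-a)))
          \<le> d powr (-a) - (real m * d) powr (-a)"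
    by (rule left_interaction_le(2)) (use exponent \<open>d > 0\<close> i sgn gap_pos sep t in auto)
  hence left: "Li - Lo \<le> d powr (-a) - (real m * d) powr (-a)"
    unfolding Li_def Lo_def sum_subtractf[symmetric] d by (simp add: algebra_simps)
  have "{i<..<m} = insert (Suc i) {Suc i<..<m}" using i by auto
  hence sum_i: "(\<Sum>j\<in>{i<..<m}. c i * c j * (?Y j - ?Y i) powr (-a)) = d powr (-a) + Ro"
    using i sgn_square[of i] unfolding Ro_def d by simp
  have sum_Suc: "(\<Sum>j<Suc i. c (Suc i) * c j * (?Y (Suc i) - ?Y j) powr (-a)) = d powr (-a) + Lo"
    using i sgn_square[of i] unfolding Lo_def d by simp
  have "\<bar>v i t - (Li - (d powr (-a) + Ro))\<bar> \<le> C"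
    using velocity[of i t] i t unfolding sum_i Li_def by simp
  moreover have "\<bar>v (Suc i) t - (d powr (-a) + Lo - Ri)\<bar> \<le> C"
    using velocity[of "Suc i" t] i t unfolding sum_Suc Ri_def by simp
  ultimately show ?thesis using left right by linarith
qed

text \<open>At the first time a same-sign gap reaches \<open>\<delta>\<close> it is minimal among
  these gaps, hence strictly increasing there. This contradicts its having been larger just
  before.\<close>

lemma same_sign_gaps_bounded_below:
  obtains \<delta> where "\<delta> > 0"
    "\<And>i t. \<lbrakk>Suc i < m; c i = c (Suc i); \<sigma> \<le> t; t < \<tau>\<rbrakk> \<Longrightarrow> \<delta> \<le> y (Suc i) t - y i t"
proof -
  define P where "P = {i. Suc i < m \<and> c i = c (Suc i)}"
  have "finite P" unfolding P_def by (rule finite_subset[of _ "{..<m}"]) auto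
  \<comment> \<open>The element 1 covers the case of no same-sign neighbours. Half of
    \<open>\<delta>\<^sub>1\<close> lies strictly below all initial same-sign gaps.
    \<open>\<delta>\<^sub>2\<close> makes the repulsive remainder at least \<open>C + 1\<close>,
    thus larger than the error; \<open>Suc m\<close> avoids a division by zero.\<close>
  define \<delta>\<^sub>1 where "\<delta>\<^sub>1 = Min (insert 1 ((\<lambda>i. y (Suc i) \<sigma> - y i \<sigma>) ` P))"
  define \<delta>\<^sub>2 where "\<delta>\<^sub>2 = (C + 1) powr (-1 / a) / real (Suc m)"
  define \<delta> where "\<delta> = min (\<delta>\<^sub>1 / 2) \<delta>\<^sub>2"
  have \<delta>\<^sub>1: "0 < \<delta>\<^sub>1" unfolding \<delta>\<^sub>1_def
    using \<open>finite P\<close> gap_pos[of _ \<sigma>] interval by (auto simp: P_def)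
  have \<delta>\<^sub>1_le: "\<delta>\<^sub>1 \<le> y (Suc i) \<sigma> - y i \<sigma>" if "i \<in> P" for i
    unfolding \<delta>\<^sub>1_def using \<open>finite P\<close> that by (intro Min_le) auto
  have "\<delta> > 0" unfolding \<delta>_def \<delta>\<^sub>2_def using \<delta>\<^sub>1 const_nonneg by simp
  have strong: "C < (real m * \<delta>) powr (-a)" if "m > 0"
  proof -
    have "real m * \<delta> \<le> real (Suc m) * \<delta>\<^sub>2"
      using \<open>\<delta> > 0\<close> unfolding \<delta>_def by (intro mult_mono) auto
    also have "\<dots> = (C + 1) powr (-1 / a)" unfolding \<delta>\<^sub>2_def by simp
    finally have "((C + 1) powr (-1 / a)) powr (-a) \<le> (real m * \<delta>) powr (-a)"
      using that \<open>\<delta> > 0\<close> exponent by (intro powr_neg_antimono) auto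
    moreover have "((C + 1) powr (-1 / a)) powr (-a) = C + 1"
      using exponent const_nonneg by (simp add: powr_powr)
    ultimately show ?thesis by simp
  qed
  have "\<delta> \<le> y (Suc i) t - y i t" if it: "i \<in> P" "\<sigma> \<le> t" "t < \<tau>" for i t
  proof (rule ccontr)
    assume "\<not> \<delta> \<le> y (Suc i) t - y i t"
    hence below: "y (Suc i) t - y i t \<le> \<delta>" by simp
    have cont_gap: "continuous_on {\<sigma>..t} (\<lambda>r. y (Suc j) r - y j r)" if "j \<in> P" for j
      using that \<open>t < \<tau>\<close> unfolding P_def
      by (intro continuous_intros continuous_on_subset[OF cont]) auto
    have start: "\<delta> < y (Suc j) \<sigma> - y j \<sigma>" if "j \<in> P" for j
      using \<delta>\<^sub>1_le[OF that] \<delta>\<^sub>1 unfolding \<delta>_def by simp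
    obtain r p where r: "\<sigma> < r" "r \<le> t" "p \<in> P" "y (Suc p) r - y p r = \<delta>"
        "\<And>q. q \<in> P \<Longrightarrow> \<delta> \<le> y (Suc q) r - y q r"
        "\<And>s. \<sigma> \<le> s \<Longrightarrow> s < r \<Longrightarrow> \<delta> < y (Suc p) s - y p s"
      using first_crossing_time[of P \<sigma> t "\<lambda>j r. y (Suc j) r - y j r" \<delta> i,
          OF \<open>finite P\<close> cont_gap start it(1) below it(2)] by blast
    have p: "Suc p < m" "c p = c (Suc p)" using r(3) unfolding P_def by auto
    have "0 < 2 * (real m * \<delta>) powr (-a) - 2 * C" using strong p by simp
    also have "\<dots> \<le> v (Suc p) r - v p r"
      by (rule same_sign_gap_growth[OF p]) (use r that in \<open>auto simp: P_def\<close>)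
    finally have "0 < v (Suc p) r - v p r" .
    moreover have "((\<lambda>r. y (Suc p) r - y p r) has_real_derivative v (Suc p) r - v p r) (at r)"
      using r p that by (intro derivative_intros deriv) auto
    ultimately obtain e where e: "e > 0"
        "\<And>h. \<lbrakk>0 < h; h < e\<rbrakk> \<Longrightarrow> y (Suc p) (r - h) - y p (r - h) < y (Suc p) r - y p r"
      using DERIV_pos_inc_left by blast
    \<comment> \<open>The cap \<open>r - \<sigma>\<close> keeps the earlier time inside the interval
      on which the gap is known to exceed \<open>\<delta>\<close>.\<close>
    define h where "h = min (e / 2) (r - \<sigma>)"
    have "0 < h" "h < e" "\<sigma> \<le> r - h" unfolding h_def using e(1) r(1) by auto
    with e(2)[of h] r(4) r(6)[of "r - h"] show False by simp
  qed
  with \<open>\<delta> > 0\<close> that[of \<delta>] show ?thesis unfolding P_def by blast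
qed

text \<open>Whatever the signs, each term is at most as strong as one from the nearest left
  neighbour, and there are at most \<open>m\<close> of them.\<close>

lemma left_force_ge:
  assumes "Suc i < m" "\<sigma> < t" "t < \<tau>"
  shows "- (real m * (y (Suc i) t - y i t) powr (-a))
     \<le> (\<Sum>j<Suc i. c (Suc i) * c j * (y (Suc i) t - y j t) powr (-a))"
proof -
  have gap: "0 < y (Suc i) t - y i t" using gap_pos[OF assms(1), of t] assms by simp
  have "(\<Sum>j<Suc i. - ((y (Suc i) t - y i t) powr (-a)))
      \<le> (\<Sum>j<Suc i. c (Suc i) * c j * (y (Suc i) t - y j t) powr (-a))"
  proof (rule sum_mono)
    fix j assume j: "j \<in> {..<Suc i}"
    have "y j t \<le> y i t"
      using strict_increasing_lessThan[of m "\<lambda>j. y j t" j i] gap_pos[of _ t] j assms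
      by (cases "j = i") auto
    hence "(y (Suc i) t - y j t) powr (-a) \<le> (y (Suc i) t - y i t) powr (-a)"
      using gap exponent by (intro powr_neg_antimono) auto
    moreover have "c (Suc i) * c j = 1 \<or> c (Suc i) * c j = -1"
      using sgn[of "Suc i"] sgn[of j] j assms by auto
    moreover have "- ((y (Suc i) t - y i t) powr (-a)) \<le> 0" "0 \<le> (y (Suc i) t - y j t) powr (-a)"
      by simp_all
    ultimately show "- ((y (Suc i) t - y i t) powr (-a)) \<le> c (Suc i) * c j * (y (Suc i) t - y j t) powr (-a)"
      by (elim disjE; simp only: mult_1 mult_minus1)
  qed
  moreover have "real (Suc i) * (y (Suc i) t - y i t) powr (-a) \<le> real m * (y (Suc i) t - y i t) powr (-a)"
    using assms by (intro mult_right_mono) auto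
  ultimately show ?thesis by simp
qed

text \<open>The same estimate by the nearest neighbour, now on the right.\<close>

lemma right_force_ge:
  assumes "Suc i < m" "\<sigma> < t" "t < \<tau>"
  shows "- (real m * (y (Suc i) t - y i t) powr (-a))
     \<le> (\<Sum>j\<in>{i<..<m}. c i * c j * (y j t - y i t) powr (-a))"
proof -
  have gap: "0 < y (Suc i) t - y i t" using gap_pos[OF assms(1), of t] assms by simp
  have "(\<Sum>j\<in>{i<..<m}. - ((y (Suc i) t - y i t) powr (-a)))
      \<le> (\<Sum>j\<in>{i<..<m}. c i * c j * (y j t - y i t) powr (-a))"
  proof (rule sum_mono)
    fix j assume j: "j \<in> {i<..<m}"
    have "y (Suc i) t \<le> y j t"
      using strict_increasing_lessThan[of m "\<lambda>j. y j t" "Suc i" j] gap_pos[of _ t] j assms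
      by (cases "j = Suc i") auto
    hence "(y j t - y i t) powr (-a) \<le> (y (Suc i) t - y i t) powr (-a)"
      using gap exponent by (intro powr_neg_antimono) auto
    moreover have "c i * c j = 1 \<or> c i * c j = -1"
      using sgn[of i] sgn[of j] j assms by auto
    moreover have "- ((y (Suc i) t - y i t) powr (-a)) \<le> 0" "0 \<le> (y j t - y i t) powr (-a)"
      by simp_all
    ultimately show "- ((y (Suc i) t - y i t) powr (-a)) \<le> c i * c j * (y j t - y i t) powr (-a)"
      by (elim disjE; simp only: mult_1 mult_minus1)
  qed
  moreover have "real (card {i<..<m}) * (y (Suc i) t - y i t) powr (-a)
      \<le> real m * (y (Suc i) t - y i t) powr (-a)"
    by (intro mult_right_mono) auto
  ultimately show ?thesis by simp
qed

text \<open>With same-sign gaps at least \<open>\<delta>\<close>, the push from either side is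
  bounded and goes into \<open>B\<close>. The pull towards a side is estimated by the gap to the
  neighbour there, with \<open>N\<close> equal to \<open>real m\<close>.\<close>

lemma holder:
  assumes "i < m"
  shows "holder_continuous_on (1 / (1 + a)) {\<sigma>..\<tau>} (y i)"
proof -
  obtain \<delta> where "\<delta> > 0" and
    \<delta>: "\<And>i t. \<lbrakk>Suc i < m; c i = c (Suc i); \<sigma> \<le> t; t < \<tau>\<rbrakk> \<Longrightarrow> \<delta> \<le> y (Suc i) t - y i t"
    using same_sign_gaps_bounded_below by blast
  define B where "B = real m * \<delta> powr (-a) + C"
  have right: "(\<Sum>j\<in>{i<..<m}. c i * c j * (y j t - y i t) powr (-a)) \<le> real m * \<delta> powr (-a)"
    if "i < m" "\<sigma> < t" "t < \<tau>" for i t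
    by (rule right_interaction_le(1)) (use exponent \<open>\<delta> > 0\<close> that sgn gap_pos \<delta> in auto)
  have left: "(\<Sum>j<i. c i * c j * (y i t - y j t) powr (-a)) \<le> real m * \<delta> powr (-a)"
    if "i < m" "\<sigma> < t" "t < \<tau>" for i t
    by (rule left_interaction_le(1)) (use exponent \<open>\<delta> > 0\<close> that sgn gap_pos \<delta> in auto)
  interpret gap_controlled m y v \<sigma> \<tau> a B "real m" W
  proof
    show "B \<ge> 0" unfolding B_def using const_nonneg by simp
    fix i t
    show "- B \<le> v 0 t" if "0 < m" "\<sigma> < t" "t < \<tau>"
      using velocity[OF that] right[OF that] unfolding B_def by simp
    show "v (m - 1) t \<le> B" if "0 < m" "\<sigma> < t" "t < \<tau>"
    proof -
      have "{m - 1<..<m} = {}" "m - 1 < m" using that by auto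
      with velocity[of "m - 1" t] left[of "m - 1" t] that show ?thesis
        unfolding B_def by simp linarith
    qed
    show "- (real m * (y (Suc i) t - y i t) powr (-a)) - B \<le> v (Suc i) t"
      if "Suc i < m" "\<sigma> < t" "t < \<tau>"
      using velocity[OF that] right[OF that] left_force_ge[OF that] unfolding B_def by linarith
    show "v i t \<le> real m * (y (Suc i) t - y i t) powr (-a) + B"
      if "Suc i < m" "\<sigma> < t" "t < \<tau>"
      using velocity[OF Suc_lessD[OF that(1)] that(2,3)] left[OF Suc_lessD[OF that(1)] that(2,3)]
        right_force_ge[OF that] unfolding B_def by linarith
  qed (use exponent interval const_nonneg cont deriv gap_pos gap_le in auto)
  \<comment> \<open>\<open>holder\<close> is here the fact supplied by the interpretation of
    \<open>gap_controlled\<close>.\<close>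
  show ?thesis by (rule holder[OF assms])
qed

end

section \<open>Reduction of the particle system to the power-law system\<close>

lemma f_sing_pos: "z > 0 \<Longrightarrow> f_sing a z = z powr (-a)"
  unfolding f_sing_def by (simp add: powr_minus divide_simps)

lemma f_sing_minus: "f_sing a (- z) = - f_sing a z"
  unfolding f_sing_def by (simp add: sgn_minus)

text \<open>The regular part is bounded near 0 by its one-sided limit, and on the rest of the
  positive range by compactness. Negative arguments follow because \<open>f\<close> and
  \<open>f_sing a\<close> are both odd.\<close>

lemma admissible_force_near_sing:
  assumes "admissible_force a f"
  obtains M where "M \<ge> 0" "\<And>z. \<lbrakk>z \<noteq> 0; \<bar>z\<bar> \<le> W\<rbrakk> \<Longrightarrow> \<bar>f z - f_sing a z\<bar> \<le> M"
proof -
  obtain h l where odd: "\<And>z. z \<noteq> 0 \<Longrightarrow> f (- z) = - f z"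
    and h: "\<And>z. z \<noteq> 0 \<Longrightarrow> f z = f_sing a z + h z"
    and C1: "h C1_differentiable_on (- {0})" and lim: "(h \<longlongrightarrow> l) (at_right 0)"
    using assms unfolding admissible_force_def by blast
  have "\<forall>\<^sub>F z in at_right 0. dist (h z) l < 1"
    using lim by (rule tendstoD) simp
  then obtain e where e: "e > 0" "\<And>z. \<lbrakk>0 < z; z < e\<rbrakk> \<Longrightarrow> dist (h z) l < 1"
    unfolding eventually_at_right_field by auto
  have "continuous_on {e..W} h"
    using C1_differentiable_imp_continuous_on[OF C1] e(1) by (auto intro: continuous_on_subset)
  hence "bounded (h ` {e..W})"
    by (intro compact_imp_bounded compact_continuous_image) auto
  then obtain M where M: "\<And>z. z \<in> {e..W} \<Longrightarrow> \<bar>h z\<bar> \<le> M"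
    unfolding bounded_iff real_norm_def by blast
  define M' where "M' = max M (\<bar>l\<bar> + 1)"
  have pos: "\<bar>h z\<bar> \<le> M'" if "0 < z" "z \<le> W" for z
    using e(2)[of z] M[of z] that unfolding M'_def dist_real_def by (cases "z < e") auto
  show ?thesis
  proof (rule that[of M'])
    fix z assume z: "z \<noteq> 0" "\<bar>z\<bar> \<le> W"
    show "\<bar>f z - f_sing a z\<bar> \<le> M'"
    proof (cases "z > 0")
      case True
      with z pos[of z] h[of z] show ?thesis by simp
    next
      case False
      with z pos[of "- z"] h[of "- z"] odd[of z] f_sing_minus[of a z] show ?thesis by simp
    qed
  qed (simp add: M'_def)
qed

lemma obtain_increasing_enumeration:
  fixes p :: "'i \<Rightarrow> real"
  assumes "finite I" "inj_on p I"
  obtains e where "bij_betw e {..<card I} I" "\<And>i j. \<lbrakk>i < j; j < card I\<rbrakk> \<Longrightarrow> p (e i) < p (e j)"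
proof -
  define h where "h = (!) (sorted_list_of_set (p ` I))"
  have card: "card (p ` I) = card I" using assms(2) by (rule card_image)
  have h: "bij_betw h {..<card I} (p ` I)"
    unfolding h_def using assms(1) card by (intro bij_betw_nth) auto
  have mono: "h i < h j" if "i < j" "j < card I" for i j
    unfolding h_def using strict_sorted_list_of_set[of "p ` I"] that card
    by (intro sorted_wrt_nth_less[where P = "(<)"]) auto
  define e where "e = inv_into I p \<circ> h"
  have "bij_betw e {..<card I} I"
    unfolding e_def
    by (intro bij_betw_trans[OF h] bij_betw_inv_into inj_on_imp_bij_betw assms(2))
  moreover have "p (e i) < p (e j)" if "i < j" "j < card I" for i j
  proof -
    have "h i \<in> p ` I" "h j \<in> p ` I" using h that by (auto simp: bij_betw_def)
    with mono[OF that] show ?thesis unfolding e_def by (simp add: f_inv_into_f)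
  qed
  ultimately show ?thesis using that by blast
qed

lemma order_preserved:
  fixes u w :: "real \<Rightarrow> real"
  assumes "continuous_on {\<sigma>..t} u" "continuous_on {\<sigma>..t} w" "\<sigma> \<le> t" "u \<sigma> < w \<sigma>"
    and "\<And>r. r \<in> {\<sigma>..t} \<Longrightarrow> u r \<noteq> w r"
  shows "u t < w t"
proof (rule ccontr)
  assume "\<not> u t < w t"
  moreover have "continuous_on {\<sigma>..t} (\<lambda>r. u r - w r)" using assms by (intro continuous_intros)
  ultimately obtain r where "\<sigma> \<le> r" "r \<le> t" "u r - w r = 0"
    using IVT'[of "\<lambda>r. u r - w r" \<sigma> 0 t] assms(3,4) by auto
  with assms(5)[of r] show False by simp
qed

text \<open>Since no particles meet before \<open>\<tau>\<close>, their order at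
  \<open>\<sigma>\<close> persists, and numbering them by initial position gives an instance of
  \<open>ordered_particles\<close>.\<close>

lemma holder_until_collision:
  fixes x :: "'i \<Rightarrow> real \<Rightarrow> real" and b :: "'i \<Rightarrow> real"
  assumes "a > 0" "admissible_force a f" "continuous_on UNIV g" "finite I"
    and sgn: "\<And>i. i \<in> I \<Longrightarrow> b i \<in> {-1, 1}" and "\<sigma> < \<tau>"
    and cont: "\<And>i. i \<in> I \<Longrightarrow> continuous_on {\<sigma>..\<tau>} (x i)"
    and inj: "\<And>t. t \<in> {\<sigma>..<\<tau>} \<Longrightarrow> inj_on (\<lambda>i. x i t) I"
    and deriv: "\<And>i t. \<lbrakk>i \<in> I; t \<in> {\<sigma><..<\<tau>}\<rbrakk> \<Longrightarrow>
        (x i has_real_derivative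
          (\<Sum>j\<in>I - {i}. b i * b j * f (x i t - x j t)) + b i * g (x i t)) (at t)"
    and "i \<in> I"
  shows "holder_continuous_on (1 / (1 + a)) {\<sigma>..\<tau>} (x i)"
proof -
  define m where "m = card I"
  obtain e where e: "bij_betw e {..<m} I" "\<And>i j. \<lbrakk>i < j; j < m\<rbrakk> \<Longrightarrow> x (e i) \<sigma> < x (e j) \<sigma>"
    unfolding m_def using obtain_increasing_enumeration[OF \<open>finite I\<close> inj[of \<sigma>]] \<open>\<sigma> < \<tau>\<close> by auto
  have eI: "e i \<in> I" if "i < m" for i using e(1) that by (auto simp: bij_betw_def)
  have ordered: "x (e i) t < x (e j) t" if "i < j" "j < m" "\<sigma> \<le> t" "t < \<tau>" for i j t
  proof (rule order_preserved[of \<sigma> t])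
    have "e i \<noteq> e j" using e(1) that by (auto simp: bij_betw_def inj_on_def)
    then show "x (e i) r \<noteq> x (e j) r" if "r \<in> {\<sigma>..t}" for r
      using inj[of r] eI[of i] eI[of j] that \<open>i < j\<close> \<open>j < m\<close> \<open>t < \<tau>\<close> by (auto simp: inj_on_def)
  qed (use that e(2) eI cont in \<open>auto intro: continuous_on_subset[OF cont]\<close>)
  \<comment> \<open>Continuity up to and including \<open>\<tau>\<close> confines all trajectories
    to a compact interval. This bounds \<open>g\<close> along them, the gaps, and the difference
    between \<open>f\<close> and its singular part.\<close>
  have "bounded (\<Union>i\<in>I. x i ` {\<sigma>..\<tau>})"
    using \<open>finite I\<close> cont by (intro compact_imp_bounded compact_UN compact_continuous_image) auto
  then obtain X where X: "\<And>z. z \<in> (\<Union>i\<in>I. x i ` {\<sigma>..\<tau>}) \<Longrightarrow> \<bar>z\<bar> \<le> X"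
    unfolding bounded_iff real_norm_def by blast
  have X: "\<bar>x i t\<bar> \<le> X" if "i \<in> I" "t \<in> {\<sigma>..\<tau>}" for i t
    by (rule X) (use that in blast)
  have "X \<ge> 0" using X[OF \<open>i \<in> I\<close>, of \<sigma>] \<open>\<sigma> < \<tau>\<close> by auto
  have "bounded (g ` {-X..X})"
    using assms(3) by (intro compact_imp_bounded compact_continuous_image) (auto intro: continuous_on_subset)
  then obtain G where G: "\<And>z. z \<in> g ` {-X..X} \<Longrightarrow> \<bar>z\<bar> \<le> G"
    unfolding bounded_iff real_norm_def by blast
  have G: "\<bar>g z\<bar> \<le> G" if "\<bar>z\<bar> \<le> X" for z
    by (rule G) (use that in \<open>simp add: abs_le_iff\<close>)
  have "G \<ge> 0" using G[of 0] \<open>X \<ge> 0\<close> by auto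
  obtain M where "M \<ge> 0" and M: "\<And>z. \<lbrakk>z \<noteq> 0; \<bar>z\<bar> \<le> 2 * X\<rbrakk> \<Longrightarrow> \<bar>f z - f_sing a z\<bar> \<le> M"
    using admissible_force_near_sing[OF assms(2)] by blast
  define v where
    "v i t = (\<Sum>j\<in>I - {e i}. b (e i) * b j * f (x (e i) t - x j t)) + b (e i) * g (x (e i) t)" for i t
  have velocity: "\<bar>v i t - ((\<Sum>j<i. b (e i) * b (e j) * (x (e i) t - x (e j) t) powr (-a)) -
      (\<Sum>j\<in>{i<..<m}. b (e i) * b (e j) * (x (e j) t - x (e i) t) powr (-a)))\<bar> \<le> real m * M + G"
    if i: "i < m" and t: "\<sigma> < t" "t < \<tau>" for i t
  proof -
    let ?z = "\<lambda>j. x (e i) t - x (e j) t"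
    have bij: "bij_betw e ({..<m} - {i}) (I - {e i})"
      using e(1) i by (auto simp: bij_betw_def inj_on_def)
    have v: "v i t = (\<Sum>j\<in>{..<m} - {i}. b (e i) * b (e j) * f (?z j)) + b (e i) * g (x (e i) t)"
      unfolding v_def sum.reindex_bij_betw[OF bij, symmetric] by simp
    have split: "(\<Sum>j\<in>{..<m} - {i}. \<phi> j) = (\<Sum>j<i. \<phi> j) + (\<Sum>j\<in>{i<..<m}. \<phi> j)" for \<phi> :: "nat \<Rightarrow> real"
    proof -
      have "{..<m} - {i} = {..<i} \<union> {i<..<m}" using i by auto
      then show ?thesis by (simp add: sum.union_disjoint[of "{..<i}" "{i<..<m}"] disjoint_iff)
    qed
    have "(\<Sum>j<i. b (e i) * b (e j) * ?z j powr (-a)) = (\<Sum>j<i. b (e i) * b (e j) * f_sing a (?z j))"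
      using ordered[of _ i t] i t by (intro sum.cong) (auto simp: f_sing_pos)
    \<comment> \<open>For particles on the right \<open>?z j\<close> is negative, so oddness of
      \<open>f_sing\<close> produces the minus sign of the second sum in
      \<open>velocity\<close>.\<close>
    moreover have "(\<Sum>j\<in>{i<..<m}. b (e i) * b (e j) * (x (e j) t - x (e i) t) powr (-a))
        = - (\<Sum>j\<in>{i<..<m}. b (e i) * b (e j) * f_sing a (?z j))"
      unfolding sum_negf[symmetric]
    proof (rule sum.cong)
      fix j assume "j \<in> {i<..<m}"
      hence "f_sing a (x (e j) t - x (e i) t) = (x (e j) t - x (e i) t) powr (-a)"
        using ordered[of i j t] i t by (auto intro: f_sing_pos)
      then show "b (e i) * b (e j) * (x (e j) t - x (e i) t) powr (-a) = - (b (e i) * b (e j) * f_sing a (?z j))"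
        using f_sing_minus[of a "?z j"] by simp
    qed simp
    ultimately have eq: "v i t - ((\<Sum>j<i. b (e i) * b (e j) * ?z j powr (-a)) -
      (\<Sum>j\<in>{i<..<m}. b (e i) * b (e j) * (x (e j) t - x (e i) t) powr (-a)))
      = (\<Sum>j\<in>{..<m} - {i}. b (e i) * b (e j) * (f (?z j) - f_sing a (?z j))) + b (e i) * g (x (e i) t)"
      unfolding v right_diff_distrib sum_subtractf split by simp
    have abs_b: "\<bar>b (e j)\<bar> = 1" if "j < m" for j using sgn[OF eI[OF that]] by auto
    have "\<bar>\<Sum>j\<in>{..<m} - {i}. b (e i) * b (e j) * (f (?z j) - f_sing a (?z j))\<bar> \<le> (\<Sum>j\<in>{..<m} - {i}. M)"
    proof (rule order_trans[OF sum_abs sum_mono])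
      fix j assume j: "j \<in> {..<m} - {i}"
      have "?z j \<noteq> 0" using ordered[of i j t] ordered[of j i t] i j t by (cases "i < j") auto
      moreover have "\<bar>?z j\<bar> \<le> 2 * X" using X[OF eI[OF i], of t] X[OF eI[of j], of t] i j t by auto
      ultimately have "\<bar>f (?z j) - f_sing a (?z j)\<bar> \<le> M" by (rule M)
      then show "\<bar>b (e i) * b (e j) * (f (?z j) - f_sing a (?z j))\<bar> \<le> M"
        using abs_b[OF i] abs_b[of j] j by (simp add: abs_mult)
    qed
    also have "\<dots> \<le> real m * M" using i \<open>M \<ge> 0\<close> by (simp add: mult_right_mono)
    finally have "\<bar>\<Sum>j\<in>{..<m} - {i}. b (e i) * b (e j) * (f (?z j) - f_sing a (?z j))\<bar> \<le> real m * M" .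
    moreover have "\<bar>b (e i) * g (x (e i) t)\<bar> \<le> G"
      using abs_b[OF i] G[OF X[OF eI[OF i], of t]] t by (simp add: abs_mult)
    ultimately show ?thesis unfolding eq by linarith
  qed
  interpret ordered_particles m "\<lambda>i. b (e i)" "\<lambda>i. x (e i)" v \<sigma> \<tau> a "real m * M + G" "2 * X"
  proof
    show "x (e (Suc i)) t - x (e i) t \<le> 2 * X" if "Suc i < m" "\<sigma> \<le> t" "t \<le> \<tau>" for i t
      using X[OF eI[of i], of t] X[OF eI[of "Suc i"], of t] that by auto
    show "b (e i) \<in> {-1, 1}" if "i < m" for i using sgn[OF eI[OF that]] .
  qed (use \<open>a > 0\<close> \<open>\<sigma> < \<tau>\<close> \<open>M \<ge> 0\<close> \<open>G \<ge> 0\<close> \<open>X \<ge> 0\<close> cont eI ordered velocity deriv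
      in \<open>auto simp: v_def\<close>)
  obtain k where "k < m" "e k = i" using e(1) \<open>i \<in> I\<close> by (auto simp: bij_betw_def)
  with holder[of k] show ?thesis by simp
qed

section \<open>Conclusion on each interval between collision times\<close>

theorem theorem1p2:
  fixes n K :: nat and T a :: real
    and b x0 \<tau> :: "nat \<Rightarrow> real"
    and f g :: "real \<Rightarrow> real"
    and I :: "nat \<Rightarrow> nat set"
    and x :: "nat \<Rightarrow> real \<Rightarrow> real"
  assumes "n \<ge> 1" and "T > 0" and "a > 0"
    and "\<forall>i\<in>{1..n}. b i \<in> {-1, 1}"
    and "admissible_force a f"
    and "\<exists>L. lipschitz_on L UNIV g"
    and "strict_mono_on {1..n} x0"
    and "annihilation_solution n T b f g x0 K \<tau> I x"
  shows "\<forall>k\<in>{1..K+1}. \<forall>i\<in>I k.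
           holder_continuous_on (1 / (1 + a)) {\<tau> (k - 1)..\<tau> k} (x i)"
proof (intro ballI)
  fix k i assume k: "k \<in> {1..K+1}" and i: "i \<in> I k"
  note sol = assms(8)[unfolded annihilation_solution_def]
  \<comment> \<open>The index is shifted because the surviving sets start at \<open>I 1\<close>.
    Inclusion in \<open>{1..n}\<close> provides finiteness and the signs of the survivors.\<close>
  have "Suc l \<le> K + 1 \<Longrightarrow> I (Suc l) \<subseteq> {1..n}" for l
  proof (induction l)
    case (Suc l)
    moreover have "I (Suc l + 1) \<subset> I (Suc l)" using sol Suc.prems by auto
    ultimately show ?case by auto
  qed (use sol in auto)
  from this[of "k - 1"] have sub: "I k \<subseteq> {1..n}" using k by (cases k) auto
  have "continuous_on UNIV g" using assms(6) lipschitz_on_continuous_on by blast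
  then show "holder_continuous_on (1 / (1 + a)) {\<tau> (k - 1)..\<tau> k} (x i)"
  proof (rule holder_until_collision[where I = "I k" and b = b, OF assms(3,5)])
    show "finite (I k)" using sub by (rule finite_subset) simp
  qed (use sol k i sub assms(4) in blast)+
qed

end
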